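(* Let $\mathbb{F}$ be a field of characteristic $0$ and let $f\colon\mathbb{F}\to\mathbb{F}$ be an SD map. Then $f$ fixes the prime subfield $\mathbb{Q}\subseteq\mathbb{F}$ pointwise.
   Context: An SD map on a field $\mathbb{F}$ is a function $f\colon \mathbb{F}\to\mathbb{F}$ such that for all $x \neq y$ in $\mathbb{F}$ one has $f(x)\neq f(y)$ and $f\left(\frac{x+y}{x-y}\right) = \frac{f(x)+f(y)}{f(x)-f(y)}$. *)

theory Defs
  imports Complex_Main
begin

definition SD_map :: "('a::field \<Rightarrow> 'a) \<Rightarrow> bool" where
  "SD_map f \<longleftrightarrow>
     (\<forall>x y. x \<noteq> y \<longrightarrow>
        f x \<noteq> f y \<and> f ((x + y) / (x - y)) = (f x + f y) / (f x - f y))"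

end

theory Submission
  imports Defs
begin

text \<open>
  Comparing the functional equation at $(ty, y)$ with the one at $(t, 1)$ shows that an SD map is
  multiplicative, so that $f(x+y)\,(f(x)-f(y)) = (f(x)+f(y))\,f(x-y)$. With $a = f(2)$ this recursion
  determines $f(3)$, $f(4)$, $f(5)$ and $f(6)$; comparing the last value with $f(2)\,f(3)$ gives
  $(a-2)(a^2+1) = 0$. The case $a^2 = -1$ would mean $f(4) = f(-1)$, so $a = 2$, and then the
  recursion gives $f(n) = n$ for all natural numbers $n$.
\<close>

lemma SD_map_inj: "SD_map f \<Longrightarrow> inj f"
  unfolding SD_map_def inj_def by blast

lemma SD_map_quotient:
  "SD_map f \<Longrightarrow> x \<noteq> y \<Longrightarrow> f ((x + y) / (x - y)) = (f x + f y) / (f x - f y)"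
  unfolding SD_map_def by blast

text \<open>Pairing \<open>x \<noteq> 0\<close> with \<open>0\<close> gives the quotient
  \<open>1\<close>, so \<open>f x\<close> satisfies a linear equation whose coefficients do not
  depend on \<open>x\<close>. Unless \<open>f 0 = 0\<close>, that equation is nondegenerate and
  forces \<open>f 1 = f 2\<close>, against injectivity.\<close>

lemma SD_map_zero:
  fixes f :: "'a::field_char_0 \<Rightarrow> 'a"
  assumes "SD_map f"
  shows "f 0 = 0"
proof (rule ccontr)
  assume c: "f 0 \<noteq> 0"
  have eq: "f x + f 0 = f 1 * (f x - f 0)" if "x \<noteq> 0" for x
    using SD_map_quotient[OF assms that] that inj_eq[OF SD_map_inj[OF assms], of x 0]
    by (simp add: field_simps)
  have "f 1 \<noteq> 1"
    using eq[of 1] c by (auto simp: algebra_simps eq_neg_iff_add_eq_0)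
  moreover have "(1 - f 1) * (f 1 - f 2) = 0"
    using eq[of 1] eq[of 2] by simp algebra
  ultimately have "f 1 = f 2"
    by simp
  then show False
    using inj_eq[OF SD_map_inj[OF assms], of 1 2] by simp
qed

lemma SD_map_eq_0_iff:
  fixes f :: "'a::field_char_0 \<Rightarrow> 'a"
  assumes "SD_map f"
  shows "f x = 0 \<longleftrightarrow> x = 0"
  using inj_eq[OF SD_map_inj[OF assms], of x 0] SD_map_zero[OF assms] by simp

lemma SD_map_one:
  fixes f :: "'a::field_char_0 \<Rightarrow> 'a"
  assumes "SD_map f"
  shows "f 1 = 1"
  using SD_map_quotient[OF assms, of 1 0] SD_map_zero[OF assms] SD_map_eq_0_iff[OF assms, of 1]
  by simp

text \<open>The pair \<open>x\<close>, \<open>- x\<close> has quotient \<open>0\<close>, so the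
  numerator \<open>f x + f (- x)\<close> must vanish.\<close>

lemma SD_map_minus:
  fixes f :: "'a::field_char_0 \<Rightarrow> 'a"
  assumes "SD_map f"
  shows "f (- x) = - f x"
proof (cases "x = 0")
  case False
  then have ne: "x \<noteq> - x"
    by simp
  with inj_eq[OF SD_map_inj[OF assms], of x "- x"] have "f x - f (- x) \<noteq> 0"
    by simp
  then have "f x + f (- x) = 0"
    using SD_map_quotient[OF assms ne] SD_map_zero[OF assms] by simp
  then show ?thesis
    by (simp add: add_eq_0_iff)
qed (simp add: SD_map_zero[OF assms])

lemma SD_map_mult:
  fixes f :: "'a::field_char_0 \<Rightarrow> 'a"
  assumes "SD_map f"
  shows "f (x * y) = f x * f y"
proof (cases "x = 1 \<or> y = 0")
  case True
  then show ?thesis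
    using SD_map_zero[OF assms] SD_map_one[OF assms] by auto
next
  case False
  note inj = inj_eq[OF SD_map_inj[OF assms]]
  have "x * y \<noteq> y"
    using False by simp
  then have ne: "f (x * y) - f y \<noteq> 0" "f x - 1 \<noteq> 0"
    using inj[of "x * y" y] inj[of x 1] False SD_map_one[OF assms] by simp_all
  have "(x * y + y) / (x * y - y) = ((x + 1) * y) / ((x - 1) * y)"
    by (simp add: algebra_simps)
  also have "\<dots> = (x + 1) / (x - 1)"
    using False by simp
  finally have "(f (x * y) + f y) / (f (x * y) - f y) = (f x + 1) / (f x - 1)"
    using SD_map_quotient[OF assms \<open>x * y \<noteq> y\<close>] SD_map_quotient[OF assms, of x 1]
      False SD_map_one[OF assms] by simp
  then have "(f (x * y) + f y) * (f x - 1) = (f x + 1) * (f (x * y) - f y)"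
    using ne by (simp add: frac_eq_eq)
  \<comment> \<open>Up to sign, this is the difference of the two cross products; characteristic 0
    then cancels the \<open>2\<close>.\<close>
  then have "2 * (f (x * y) - f x * f y) = 0"
    by algebra
  then show ?thesis
    by simp
qed

text \<open>Multiplicativity clears the denominator \<open>x - y\<close> inside \<open>f\<close>. In
  this product form the case \<open>x = y\<close> is harmless: both sides are
  \<open>0\<close>.\<close>

lemma SD_map_add_diff:
  fixes f :: "'a::field_char_0 \<Rightarrow> 'a"
  assumes "SD_map f"
  shows "f (x + y) * (f x - f y) = (f x + f y) * f (x - y)"
proof (cases "x = y")
  case True
  then show ?thesis
    using SD_map_zero[OF assms] by simp
next
  case False
  then have "f (x + y) = (f x + f y) / (f x - f y) * f (x - y)"
    using SD_map_mult[OF assms, of "(x + y) / (x - y)" "x - y"] SD_map_quotient[OF assms False]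
    by simp
  then show ?thesis
    using inj_eq[OF SD_map_inj[OF assms], of x y] False by simp
qed

lemma SD_map_two:
  fixes f :: "'a::field_char_0 \<Rightarrow> 'a"
  assumes "SD_map f"
  shows "f 2 = 2"
proof -
  note inj = inj_eq[OF SD_map_inj[OF assms]] and one = SD_map_one[OF assms]
  define a where "a = f 2"
  have a: "a \<noteq> 0" "a \<noteq> 1" "a\<^sup>2 \<noteq> 1" "a\<^sup>2 \<noteq> - 1"
    and f4: "f 4 = a\<^sup>2"
  proof -
    show f4: "f 4 = a\<^sup>2"
      using SD_map_mult[OF assms, of 2 2] by (simp add: a_def power2_eq_square)
    show "a \<noteq> 0" "a \<noteq> 1"
      using SD_map_eq_0_iff[OF assms, of 2] inj[of 2 1] one by (simp_all add: a_def)
    \<comment> \<open>Otherwise \<open>f 4\<close> would coincide with \<open>f 1\<close> or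
      \<open>f (- 1)\<close>.\<close>
    show "a\<^sup>2 \<noteq> 1" "a\<^sup>2 \<noteq> - 1"
      using inj[of 4 1] inj[of 4 "- 1"] one SD_map_minus[OF assms, of 1] f4 by simp_all
  qed
  have f3: "f 3 * (a - 1) = a + 1"
    using SD_map_add_diff[OF assms, of 2 1] one by (simp add: a_def)
  have f5: "f 5 * (a\<^sup>2 - 1) = (a\<^sup>2 + 1) * f 3"
    using SD_map_add_diff[OF assms, of 4 1] one f4 by simp
  \<comment> \<open>The pair \<open>5\<close>, \<open>1\<close> with \<open>f 6\<close> replaced by
    \<open>f 2 * f 3\<close>: this is the constraint that pins down \<open>a\<close>.\<close>
  have f6: "a * f 3 * (f 5 - 1) = (f 5 + 1) * a\<^sup>2"
    using SD_map_add_diff[OF assms, of 5 1] SD_map_mult[OF assms, of 2 3] one f4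
    by (simp add: a_def)
  have "(a + 1) * (f 5 * (a - 1)\<^sup>2 - (a\<^sup>2 + 1)) = 0"
    using arg_cong[OF f5, of "\<lambda>t. t * (a - 1)"] f3 by algebra
  moreover have "a + 1 \<noteq> 0"
    using a(3) by (auto simp: add_eq_0_iff2)
  ultimately have f5': "f 5 * (a - 1)\<^sup>2 = a\<^sup>2 + 1"
    by simp
  have diff: "(f 5 - 1) * (a - 1)\<^sup>2 = 2 * a"
    and sum: "(f 5 + 1) * (a - 1)\<^sup>2 = 2 * a\<^sup>2 - 2 * a + 2"
    using f5' by (simp_all add: power2_eq_square algebra_simps)
  \<comment> \<open>Scaling \<open>f6\<close> by the cube of \<open>a - 1\<close> turns every
    occurrence of \<open>f 3\<close> and \<open>f 5\<close> into a polynomial in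
    \<open>a\<close>.\<close>
  have "a * (f 3 * (a - 1)) * ((f 5 - 1) * (a - 1)\<^sup>2)
      = a * f 3 * (f 5 - 1) * ((a - 1) * (a - 1)\<^sup>2)"
    by (simp only: ac_simps)
  also have "\<dots> = a\<^sup>2 * (a - 1) * ((f 5 + 1) * (a - 1)\<^sup>2)"
    unfolding f6 by (simp only: ac_simps)
  finally have "a * (a + 1) * (2 * a) = a\<^sup>2 * (a - 1) * (2 * a\<^sup>2 - 2 * a + 2)"
    unfolding f3 diff sum .
  then have "2 * a\<^sup>2 * ((a - 2) * (a\<^sup>2 + 1)) = 0"
    by (simp add: algebra_simps power2_eq_square)
  then have "a = 2 \<or> a\<^sup>2 + 1 = 0"
    using a(1) by simp
  then show ?thesis
    using a(4) by (auto simp: a_def add_eq_0_iff2)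
qed

lemma SD_map_of_nat:
  fixes f :: "'a::field_char_0 \<Rightarrow> 'a"
  assumes "SD_map f"
  shows "f (of_nat n) = of_nat n"
proof (induction n rule: less_induct)
  case (less n)
  \<comment> \<open>The value at \<open>2\<close> has to be a base case: the pair \<open>1\<close>,
    \<open>1\<close> makes both sides of the recursion \<open>0\<close>. From \<open>3\<close> on,
    the pair \<open>m + 2\<close>, \<open>1\<close> has the nonzero factor
    \<open>f (m + 2) - 1 = m + 1\<close>.\<close>
  consider "n = 0" | "n = 1" | "n = 2" | m where "n = m + 3"
    using le_add_diff_inverse2[of 3 n]
    by (metis One_nat_def Suc_1 less_Suc0 less_SucE not_le numeral_3_eq_3)
  then show ?case
  proof cases
    case (4 m)
    have "f (of_nat (m + 2)) = of_nat (m + 2)" "f (of_nat (m + 1)) = of_nat (m + 1)"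
      using less.IH[of "m + 2"] less.IH[of "m + 1"] 4 by simp_all
    moreover have "of_nat (m + 2) + 1 = (of_nat n :: 'a)" "of_nat (m + 2) - 1 = (of_nat (m + 1) :: 'a)"
      using 4 by simp_all
    ultimately have "f (of_nat n) * of_nat (m + 1) = of_nat n * of_nat (m + 1)"
      using SD_map_add_diff[OF assms, of "of_nat (m + 2)" 1] SD_map_one[OF assms] by simp
    moreover have "of_nat (m + 1) \<noteq> (0 :: 'a)"
      by (simp only: of_nat_eq_0_iff)
    ultimately show ?thesis
      by (metis mult_right_cancel)
  qed (use SD_map_zero[OF assms] SD_map_one[OF assms] SD_map_two[OF assms] in simp_all)
qed

lemma SD_map_of_int:
  fixes f :: "'a::field_char_0 \<Rightarrow> 'a"
  assumes "SD_map f"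
  shows "f (of_int k) = of_int k"
  by (cases k rule: int_cases2) (simp_all add: SD_map_of_nat[OF assms] SD_map_minus[OF assms])

theorem theorem3p2:
  fixes f :: "'a::field_char_0 \<Rightarrow> 'a"
  assumes "SD_map f"
  shows "\<forall>q\<in>\<rat>. f q = q"
proof
  fix q :: 'a
  assume "q \<in> \<rat>"
  then obtain a b where q: "b > 0" "q = of_int a / of_int b"
    by (elim Rats_cases')
  then have "f q * of_int b = of_int a"
    using SD_map_mult[OF assms, of q "of_int b"] by (simp add: SD_map_of_int[OF assms])
  then have "f q = of_int a / of_int b"
    using q(1) by (simp add: eq_divide_eq)
  then show "f q = q"
    using q(2) by simp
qed

end
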